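(* Let $N \geq 3$ and let $a_1,\dots,a_N$ be positive integers with $\gcd(a_1,\dots,a_N)=1$; write ${\boldsymbol a}=(a_1,\dots,a_N)$. Let $s \geq 0$ be an integer and let $g_s({\boldsymbol a})$ be the $s$-Frobenius number of ${\boldsymbol a}$. Then $$g_s({\boldsymbol a}) \leq \max \left\{ \frac{R_{{\boldsymbol a}} (N-1) \sum_{i=1}^N \|{\boldsymbol \alpha}_i\| a_i}{\|{\boldsymbol a}\|} + 1,\ \left( s\, (N-1)! \prod_{i=1}^N a_i \right)^{\frac{1}{N-2}} \right\}.$$ If in addition $s \leq \tau_{N-1}+1$, then $$g_s({\boldsymbol a}) \leq \frac{3 R_{{\boldsymbol a}} \sum_{i=1}^N \|{\boldsymbol \alpha}_i\| a_i}{\|{\boldsymbol a}\|}.$$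
   Context: A positive integer $t$ is representable by ${\boldsymbol a}$ if $t=\sum_{i=1}^N a_ix_i$ with $x_1,\dots,x_N$ nonnegative integers; each such ${\boldsymbol x}=(x_1,\dots,x_N)$ is a representation of $t$. For an integer $s\ge 0$, the $s$-Frobenius number $g_s({\boldsymbol a})$ is the largest positive integer that has precisely $s$ distinct representations in terms of ${\boldsymbol a}$. $\|\cdot\|$ is the Euclidean norm, and ${\boldsymbol \alpha}_i := (a_1,\dots,a_{i-1},a_{i+1},\dots,a_N)\in\mathbb{Z}^{N-1}$. Let $\Lambda_{{\boldsymbol a}} = \{{\boldsymbol x}\in\mathbb{Z}^N : \sum_{i=1}^N a_ix_i=0\}$ and $V_{{\boldsymbol a}}=\operatorname{span}_{\mathbb R}\Lambda_{{\boldsymbol a}}$, an $(N-1)$-dimensional subspace in which $\Lambda_{{\boldsymbol a}}$ is a full-rank lattice. The covering radius is $R_{{\boldsymbol a}} := \inf\{R>0 : \Lambda_{{\boldsymbol a}} + B_{V_{{\boldsymbol a}}}(R) = V_{{\boldsymbol a}}\}$, where $B_{V_{{\boldsymbol a}}}(R)$ is the closed ball of radius $R$ centered at the origin in $V_{{\boldsymbol a}}$. $\tau_{N-1}$ denotes the kissing number in dimension $N-1$, i.e. the maximal number of non-overlapping unit balls in $\mathbb{R}^{N-1}$ that can touch another unit ball. *)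

theory Defs
  imports "HOL-Analysis.Analysis"
begin

definition representations :: "nat ^ 'n \<Rightarrow> nat \<Rightarrow> (nat ^ 'n) set" where
  "representations a t = {x. (\<Sum>i\<in>UNIV. a $ i * x $ i) = t}"

(* For a set of naturals, Sup is Max if the set is finite and nonempty, and Sup {} = 0;
   so the value is 0 if no positive integer has precisely s representations. *)
definition s_frobenius :: "nat \<Rightarrow> nat ^ 'n \<Rightarrow> nat" where
  "s_frobenius s a = Sup {t. 0 < t \<and> card (representations a t) = s}"

lemma finite_representations:
  fixes a :: "nat ^ 'n"
  assumes "\<And>i. 0 < a $ i"
  shows "finite (representations a t)"
proof -
  have "x \<in> vec_lambda ` (UNIV \<rightarrow>\<^sub>E {..t})" if "x \<in> representations a t" for x
  proof -
    have "x $ i \<le> t" for i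
    proof -
      have "x $ i \<le> a $ i * x $ i" using assms[of i] by simp
      also have "\<dots> \<le> (\<Sum>i\<in>UNIV. a $ i * x $ i)" by (rule member_le_sum) auto
      finally show ?thesis using that by (simp add: representations_def)
    qed
    then have "vec_nth x \<in> UNIV \<rightarrow>\<^sub>E {..t}" by auto
    then show ?thesis by (metis image_eqI vec_nth_inverse)
  qed
  then have "representations a t \<subseteq> vec_lambda ` (UNIV \<rightarrow>\<^sub>E {..t})" by blast
  then show ?thesis by (rule finite_subset) (intro finite_imageI finite_PiE, auto)
qed

definition rvec :: "nat ^ 'n \<Rightarrow> real ^ 'n" where
  "rvec a = (\<chi> i. real (a $ i))"

(* The Euclidean norm of the vector of length N - 1 obtained by omitting the i-th entry of a. *)
definition alpha_norm :: "nat ^ 'n \<Rightarrow> 'n \<Rightarrow> real" where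
  "alpha_norm a i = L2_set (\<lambda>j. real (a $ j)) (UNIV - {i})"

definition lattice_of :: "nat ^ 'n \<Rightarrow> (real ^ 'n) set" where
  "lattice_of a = {x. (\<forall>i. x $ i \<in> \<int>) \<and> (\<Sum>i\<in>UNIV. real (a $ i) * x $ i) = 0}"

definition space_of :: "nat ^ 'n \<Rightarrow> (real ^ 'n) set" where
  "space_of a = span (lattice_of a)"

definition covering_radius :: "nat ^ 'n \<Rightarrow> real" where
  "covering_radius a =
     Inf {R. 0 < R \<and> {l + b | l b. l \<in> lattice_of a \<and> b \<in> space_of a \<inter> cball 0 R} = space_of a}"

(* Euclidean space of dimension n, for n a term rather than a type: real sequences of
   length n (functions that are undefined outside {..<n}) with the Euclidean distance. *)
definition Rn :: "nat \<Rightarrow> (nat \<Rightarrow> real) set" where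
  "Rn n = {..<n} \<rightarrow>\<^sub>E UNIV"

definition Rn_dist :: "nat \<Rightarrow> (nat \<Rightarrow> real) \<Rightarrow> (nat \<Rightarrow> real) \<Rightarrow> real" where
  "Rn_dist n x y = L2_set (\<lambda>i. x i - y i) {..<n}"

interpretation Rn: Metric_space "Rn n" "Rn_dist n" for n
proof
  show "0 \<le> Rn_dist n x y" for x y by (simp add: Rn_dist_def)
  show "Rn_dist n x y = Rn_dist n y x" for x y
    by (simp add: Rn_dist_def L2_set_def power2_commute)
  show "Rn_dist n x y = 0 \<longleftrightarrow> x = y" if "x \<in> Rn n" "y \<in> Rn n" for x y
    using that by (auto simp: Rn_dist_def Rn_def L2_set_eq_0_iff intro: PiE_ext[of x "{..<n}" _ y])
  show "Rn_dist n x z \<le> Rn_dist n x y + Rn_dist n y z" for x y z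
    using L2_set_triangle_ineq[of "\<lambda>i. x i - y i" "\<lambda>i. y i - z i" "{..<n}"]
    by (simp add: Rn_dist_def)
qed

(* C is the set of centres of non-overlapping unit balls touching the unit ball around p. *)
definition kissing_configuration :: "nat \<Rightarrow> (nat \<Rightarrow> real) \<Rightarrow> (nat \<Rightarrow> real) set \<Rightarrow> bool" where
  "kissing_configuration n p C \<longleftrightarrow>
     p \<in> Rn n \<and> C \<subseteq> Rn n \<and> finite C \<and>
     (\<forall>c\<in>C. Rn.mball n c 1 \<inter> Rn.mball n p 1 = {} \<and> Rn.mcball n c 1 \<inter> Rn.mcball n p 1 \<noteq> {}) \<and>
     (\<forall>c\<in>C. \<forall>d\<in>C. c \<noteq> d \<longrightarrow> Rn.mball n c 1 \<inter> Rn.mball n d 1 = {})"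

definition kissing_number :: "nat \<Rightarrow> nat" where
  "kissing_number n = Sup {card C | p C. kissing_configuration n p C}"

end

theory Submission
  imports Defs
begin

text \<open>
  The representations of \<open>t\<close> are the integer points of the simplex
  \<open>S(t) = {x \<ge> 0. \<langle>a, x\<rangle> = t}\<close>, and the integer points of its affine hull form a translate of
  \<open>\<Lambda>\<^sub>a\<close>. The distance, within that hull, of \<open>x\<close> to the facet \<open>x\<^sub>i = 0\<close> is \<open>x\<^sub>i / c\<^sub>i\<close> with
  \<open>c\<^sub>i = \<parallel>\<alpha>\<^sub>i\<parallel> / \<parallel>a\<parallel>\<close>, so a point with \<open>x\<^sub>i \<ge> q c\<^sub>i\<close> for all \<open>i\<close>, where \<open>q > R\<^sub>a\<close>, has a
  representation within distance \<open>q\<close>; the inradius of \<open>S(t)\<close> is \<open>t / \<sigma>\<close> with \<open>\<sigma> = \<Sum>i. a\<^sub>i c\<^sub>i\<close>.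

  First bound: \<open>S(t)\<close> shrunk by \<open>q\<close> is a translate of \<open>S(T)\<close>, \<open>T = t - q \<sigma>\<close>. It contains at least
  \<open>T\<^bsup>N-1\<^esup> / ((N-1)! \<Prod>i\<noteq>k. a\<^sub>i)\<close> points whose coordinates other than the \<open>k\<close>-th are natural
  numbers (up to the translation). By the pigeonhole principle a fraction \<open>1 / a\<^sub>k\<close> of them lie in one
  class modulo \<open>\<Lambda>\<^sub>a\<close>, and one integer vector moves this whole class to representations.
  Bernoulli's inequality gives \<open>T\<^bsup>N-1\<^esup> \<ge> t\<^bsup>N-2\<^esup>\<close>.

  Second bound: with \<open>q = t / (3 \<sigma>)\<close> the inball has radius \<open>3 q\<close> and contains a central ball
  of radius \<open>q\<close> together with a kissing configuration around it. As \<open>N \<ge> 3\<close>, one more ball of radius \<open>q\<close>,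
  not overlapping the inball, fits into a corner of \<open>S(t)\<close>. Each of these \<open>\<tau> + 2\<close> balls contains a
  representation of its own.
\<close>

subsection \<open>The lattice and its covering radius\<close>

text \<open>For nonzero \<open>rvec a\<close>, entry i is the length of the orthogonal projection of
  the i-th unit vector to the hyperplane orthogonal to \<open>rvec a\<close>.\<close>

definition facet_ratio :: "nat ^ 'n \<Rightarrow> real ^ 'n" where
  "facet_ratio a = (\<chi> i. alpha_norm a i / norm (rvec a))"

lemma inner_rvec: "rvec a \<bullet> x = (\<Sum>i\<in>UNIV. real (a $ i) * x $ i)"
  by (simp add: inner_vec_def rvec_def)

lemma rvec_nonzero:
  assumes "\<forall>i. 0 < a $ i"
  shows "rvec a \<noteq> 0"
proof
  assume "rvec a = 0"
  then have "rvec a $ i = 0" for i by simp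
  then show False using assms by (simp add: rvec_def)
qed

lemma norm_rvec_sq: "(norm (rvec a))\<^sup>2 = (real (a $ i))\<^sup>2 + (alpha_norm a i)\<^sup>2"
  by (simp add: norm_vec_def alpha_norm_def rvec_def L2_set_def sum_nonneg sum.remove[of UNIV i])

text \<open>Cauchy-Schwarz over the indices other than i bounds a_i x_i. After squaring, adding
  \<open>(alpha_norm a i * x $ i)^2\<close> to both sides completes them to the full norms of
  \<open>rvec a\<close> and x.\<close>

lemma coordinate_bound:
  fixes a :: "nat ^ 'n" and x :: "real ^ 'n"
  assumes pos: "\<forall>i. 0 < a $ i" and x: "rvec a \<bullet> x = 0"
  shows "\<bar>x $ i\<bar> \<le> facet_ratio a $ i * norm x"
proof -
  define P where "P = L2_set (\<lambda>j. x $ j) (UNIV - {i})"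
  have na: "norm (rvec a) > 0" using rvec_nonzero[OF pos] by simp
  have al: "alpha_norm a i \<ge> 0" by (simp add: alpha_norm_def)
  have nx: "(norm x)\<^sup>2 = (x $ i)\<^sup>2 + P\<^sup>2"
    by (simp add: norm_vec_def P_def L2_set_def sum_nonneg sum.remove[of UNIV i])
  have "real (a $ i) * x $ i = - (\<Sum>j\<in>UNIV - {i}. real (a $ j) * x $ j)"
    using x by (simp add: inner_rvec sum.remove[of UNIV i])
  also have "\<bar>\<dots>\<bar> \<le> (\<Sum>j\<in>UNIV - {i}. \<bar>real (a $ j) * x $ j\<bar>)"
    unfolding abs_minus_cancel by (rule sum_abs)
  also have "\<dots> = (\<Sum>j\<in>UNIV - {i}. \<bar>real (a $ j)\<bar> * \<bar>x $ j\<bar>)"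
    by (simp only: abs_mult)
  also have "\<dots> \<le> alpha_norm a i * P"
    unfolding alpha_norm_def P_def by (rule L2_set_mult_ineq)
  finally have "\<bar>real (a $ i) * x $ i\<bar> \<le> alpha_norm a i * P" .
  then have "(real (a $ i) * x $ i)\<^sup>2 \<le> (alpha_norm a i * P)\<^sup>2"
    using abs_le_square_iff[of "real (a $ i) * x $ i" "alpha_norm a i * P"] by linarith
  then have "(norm (rvec a))\<^sup>2 * (x $ i)\<^sup>2 \<le> (alpha_norm a i)\<^sup>2 * (norm x)\<^sup>2"
    unfolding norm_rvec_sq[of a i] nx by (simp add: power_mult_distrib algebra_simps)
  then have "(norm (rvec a) * \<bar>x $ i\<bar>)\<^sup>2 \<le> (alpha_norm a i * norm x)\<^sup>2"
    by (simp add: power_mult_distrib)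
  then have "norm (rvec a) * \<bar>x $ i\<bar> \<le> alpha_norm a i * norm x"
    by (rule power2_le_imp_le) (simp add: al)
  then show ?thesis using na by (simp add: facet_ratio_def field_simps)
qed

text \<open>The vectors \<open>b i\<close> lie in the lattice (\<open>lattice_of_basis\<close>).
  They need not generate it over the integers, but their real combinations fill the hyperplane,
  which suffices for its span and for a finite covering radius.\<close>

lemma lattice_coefficients:
  fixes a :: "nat ^ 'n" and x :: "real ^ 'n" and k :: 'n
  assumes pos: "\<forall>i. 0 < a $ i" and x: "rvec a \<bullet> x = 0"
  defines "b \<equiv> \<lambda>i. real (a $ k) *\<^sub>R axis i 1 - real (a $ i) *\<^sub>R axis k (1::real)"
  shows "x = (\<Sum>i\<in>UNIV. (x $ i / real (a $ k)) *\<^sub>R b i)"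
proof -
  have "(\<Sum>i\<in>UNIV. (x $ i / real (a $ k)) *\<^sub>R b i)
      = (\<Sum>i\<in>UNIV. x $ i *\<^sub>R axis i 1 - (real (a $ i) * x $ i) *\<^sub>R ((1 / real (a $ k)) *\<^sub>R axis k 1))"
    using pos by (intro sum.cong refl) (simp add: b_def algebra_simps less_imp_neq[THEN not_sym])
  also have "\<dots> = (\<Sum>i\<in>UNIV. x $ i *\<^sub>R axis i 1)
      - (\<Sum>i\<in>UNIV. real (a $ i) * x $ i) *\<^sub>R ((1 / real (a $ k)) *\<^sub>R axis k 1)"
    by (simp only: sum_subtractf scaleR_left.sum)
  also have "\<dots> = (\<Sum>i\<in>UNIV. x $ i *\<^sub>R axis i 1)"
    using x by (simp add: inner_rvec)
  also have "\<dots> = x"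
    by (simp add: vec_eq_iff axis_def if_distrib cong: if_cong)
  finally show ?thesis by simp
qed

lemma lattice_of_basis:
  "real (a $ k) *\<^sub>R axis i 1 - real (a $ i) *\<^sub>R axis k 1 \<in> lattice_of a"
proof -
  have "(\<Sum>j\<in>UNIV. real (a $ j) * (axis l (1::real) $ j)) = real (a $ l)" for l
    by (simp add: axis_def if_distrib cong: if_cong)
  then have "rvec a \<bullet> axis l 1 = real (a $ l)" for l by (simp add: inner_rvec)
  then have "rvec a \<bullet> (real (a $ k) *\<^sub>R axis i 1 - real (a $ i) *\<^sub>R axis k 1) = 0"
    by (simp add: inner_diff_right)
  then show ?thesis unfolding lattice_of_def inner_rvec
    by (auto simp: axis_def)
qed

lemma lattice_of_sum_int:
  assumes "finite I" "\<And>i. i \<in> I \<Longrightarrow> b i \<in> lattice_of a"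
  shows "(\<Sum>i\<in>I. real_of_int (m i) *\<^sub>R b i) \<in> lattice_of a"
proof -
  have "rvec a \<bullet> (\<Sum>i\<in>I. real_of_int (m i) *\<^sub>R b i) = 0"
    using assms by (simp add: inner_sum_right lattice_of_def inner_rvec[symmetric])
  then show ?thesis using assms
    by (auto simp: lattice_of_def inner_rvec intro!: Ints_sum Ints_mult)
qed

lemma space_of_eq:
  fixes a :: "nat ^ 'n"
  assumes pos: "\<forall>i. 0 < a $ i"
  shows "space_of a = {x. rvec a \<bullet> x = 0}"
proof
  have "lattice_of a \<subseteq> {x. rvec a \<bullet> x = 0}" by (auto simp: lattice_of_def inner_rvec)
  then show "space_of a \<subseteq> {x. rvec a \<bullet> x = 0}"
    unfolding space_of_def by (rule span_minimal) (rule subspace_hyperplane)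
next
  show "{x. rvec a \<bullet> x = 0} \<subseteq> space_of a"
  proof safe
    fix x and k :: 'n assume x: "rvec a \<bullet> x = 0"
    have "(\<Sum>i\<in>UNIV. (x $ i / real (a $ k)) *\<^sub>R
        (real (a $ k) *\<^sub>R axis i 1 - real (a $ i) *\<^sub>R axis k (1::real))) \<in> space_of a"
      unfolding space_of_def by (intro span_sum span_scale span_base lattice_of_basis)
    then show "x \<in> space_of a" by (subst lattice_coefficients[OF pos x, of k])
  qed
qed

text \<open>Makes the infimum in \<open>covering_radius\<close> meaningful. Rounding down the
  coefficients of x along the \<open>b i\<close> leaves fractional parts, hence a remainder bounded
  by the sum of the norms of the \<open>b i\<close>.\<close>

lemma covering_radii_nonempty:
  fixes a :: "nat ^ 'n"
  assumes pos: "\<forall>i. 0 < a $ i"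
  shows "{R. 0 < R \<and> {l + b | l b. l \<in> lattice_of a \<and> b \<in> space_of a \<inter> cball 0 R} = space_of a} \<noteq> {}"
proof -
  fix k :: 'n
  define b where "b = (\<lambda>i. real (a $ k) *\<^sub>R axis i 1 - real (a $ i) *\<^sub>R axis k (1::real))"
  define R where "R = (\<Sum>i\<in>UNIV. norm (b i)) + 1"
  have R: "R > 0" unfolding R_def by (simp add: add_nonneg_pos sum_nonneg)
  have bl: "b i \<in> lattice_of a" for i unfolding b_def by (rule lattice_of_basis)
  have "x \<in> {l + b | l b. l \<in> lattice_of a \<and> b \<in> space_of a \<inter> cball 0 R}" if "x \<in> space_of a" for x
  proof -
    have x: "rvec a \<bullet> x = 0" using that space_of_eq[OF pos] by auto
    define c where "c = (\<lambda>i. x $ i / real (a $ k))"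
    define l where "l = (\<Sum>i\<in>UNIV. real_of_int \<lfloor>c i\<rfloor> *\<^sub>R b i)"
    have l: "l \<in> lattice_of a" unfolding l_def by (rule lattice_of_sum_int) (auto simp: bl)
    have "x = (\<Sum>i\<in>UNIV. c i *\<^sub>R b i)"
      unfolding b_def c_def by (rule lattice_coefficients[OF pos x])
    then have "x - l = (\<Sum>i\<in>UNIV. frac (c i) *\<^sub>R b i)"
      by (simp add: l_def sum_subtractf[symmetric] frac_def algebra_simps)
    also have "norm \<dots> \<le> (\<Sum>i\<in>UNIV. norm (b i))"
      by (rule sum_norm_le) (auto simp: frac_lt_1 less_imp_le mult_left_le_one_le)
    finally have "norm (x - l) \<le> R" by (simp add: R_def)
    moreover have "x - l \<in> space_of a"
      using that l unfolding space_of_def by (blast intro: span_diff span_base)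
    moreover have "x = l + (x - l)" by simp
    ultimately show ?thesis using l by (metis (mono_tags, lifting) CollectI IntI mem_cball_0)
  qed
  moreover have "{l + b | l b. l \<in> lattice_of a \<and> b \<in> space_of a \<inter> cball 0 R} \<subseteq> space_of a"
    unfolding space_of_def by (auto intro: span_add span_base)
  ultimately show ?thesis using R by blast
qed

lemma covering_radius_nonneg:
  assumes "\<forall>i. 0 < a $ i"
  shows "0 \<le> covering_radius a"
  unfolding covering_radius_def
  by (rule cInf_greatest[OF covering_radii_nonempty[OF assms]]) auto

text \<open>Taking q strictly above the infimum avoids having to show that the infimum is
  attained.\<close>

lemma covering_radius_cover:
  assumes pos: "\<forall>i. 0 < a $ i" and q: "covering_radius a < q" and x: "rvec a \<bullet> x = 0"
  obtains l where "l \<in> lattice_of a" "norm (x - l) \<le> q"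
proof -
  obtain R where R: "{l + b | l b. l \<in> lattice_of a \<and> b \<in> space_of a \<inter> cball 0 R} = space_of a" "R < q"
    using cInf_lessD[OF covering_radii_nonempty[OF pos] q[unfolded covering_radius_def]] by blast
  have "x \<in> space_of a" using x space_of_eq[OF pos] by auto
  then have "x \<in> {l + b | l b. l \<in> lattice_of a \<and> b \<in> space_of a \<inter> cball 0 R}"
    unfolding R(1) .
  then obtain l b where "x = l + b" "l \<in> lattice_of a" "norm b \<le> R"
    unfolding mem_Collect_eq Int_iff mem_cball_0 by blast
  then show ?thesis using R(2) that[of l] by auto
qed

subsection \<open>Integer points and representations\<close>

lemma bezout_finite:
  fixes f :: "'i \<Rightarrow> nat"
  assumes "finite I"
  shows "\<exists>u :: 'i \<Rightarrow> int. (\<Sum>i\<in>I. int (f i) * u i) = int (Gcd (f ` I))"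
  using assms
proof (induction I rule: finite_induct)
  case empty
  then show ?case by simp
next
  case (insert k I)
  then obtain u where u: "(\<Sum>i\<in>I. int (f i) * u i) = int (Gcd (f ` I))" by blast
  obtain p q where pq: "p * int (f k) + q * int (Gcd (f ` I)) = gcd (int (f k)) (int (Gcd (f ` I)))"
    using bezout_int by blast
  define v where "v = (\<lambda>i. if i = k then p else q * u i)"
  have "(\<Sum>i\<in>I. int (f i) * v i) = (\<Sum>i\<in>I. q * (int (f i) * u i))"
    using insert by (intro sum.cong) (auto simp: v_def)
  then have "(\<Sum>i\<in>insert k I. int (f i) * v i) = p * int (f k) + q * int (Gcd (f ` I))"
    using insert u by (simp add: v_def mult.commute flip: sum_distrib_left)
  also have "\<dots> = int (Gcd (f ` insert k I))" using pq by simp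
  finally show ?case by blast
qed

lemma integer_point_in_layer:
  fixes a :: "nat ^ 'n"
  assumes "Gcd (range (\<lambda>i. a $ i)) = 1"
  obtains z :: "real ^ 'n" where "\<forall>i. z $ i \<in> \<int>" "rvec a \<bullet> z = real t"
proof -
  obtain u where u: "(\<Sum>i\<in>UNIV. int (a $ i) * u i) = 1"
    using bezout_finite[of UNIV "\<lambda>i. a $ i"] assms by auto
  define z :: "real ^ 'n" where "z = (\<chi> i. real_of_int (int t * u i))"
  have "rvec a \<bullet> z = real_of_int (int t * (\<Sum>i\<in>UNIV. int (a $ i) * u i))"
    by (simp add: inner_rvec z_def sum_distrib_left mult_ac)
  then have "rvec a \<bullet> z = real t" using u by simp
  then show ?thesis using that[of z] by (simp add: z_def)
qed

text \<open>Subtracting one integer point of the layer turns the layer into the hyperplane and its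
  integer points into the lattice, so the covering property carries over.\<close>

lemma integer_point_near:
  fixes a :: "nat ^ 'n"
  assumes pos: "\<forall>i. 0 < a $ i" and gcd: "Gcd (range (\<lambda>i. a $ i)) = 1"
    and q: "covering_radius a < q" and u: "rvec a \<bullet> u = real t"
  obtains z where "\<forall>i. z $ i \<in> \<int>" "rvec a \<bullet> z = real t" "norm (z - u) \<le> q"
proof -
  obtain z where z: "\<forall>i. z $ i \<in> \<int>" "rvec a \<bullet> z = real t"
    using integer_point_in_layer[OF gcd] .
  have "rvec a \<bullet> (u - z) = 0" using u z by (simp add: inner_diff_right)
  then obtain l where l: "l \<in> lattice_of a" "norm (u - z - l) \<le> q"
    using covering_radius_cover[OF pos q] by metis
  have "rvec a \<bullet> l = 0" using l by (simp add: lattice_of_def inner_rvec)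
  moreover have "\<forall>i. l $ i \<in> \<int>" using l by (simp add: lattice_of_def)
  moreover have "norm (z + l - u) = norm (u - z - l)"
    by (metis diff_diff_eq norm_minus_commute)
  ultimately show ?thesis using that[of "z + l"] z l by (simp add: inner_add_right)
qed

text \<open>By \<open>coordinate_bound\<close>, a move of length at most q inside the layer lowers
  coordinate i by at most q c_i, so no coordinate of z becomes negative.\<close>

lemma integer_point_near_is_representation:
  fixes a :: "nat ^ 'n"
  assumes pos: "\<forall>i. 0 < a $ i"
    and u: "rvec a \<bullet> u = real t" "\<And>i. q * facet_ratio a $ i \<le> u $ i"
    and z: "\<forall>i. z $ i \<in> \<int>" "rvec a \<bullet> z = real t" "norm (z - u) \<le> q"
  shows "z \<in> rvec ` representations a t"
proof -
  have nn: "z $ i \<ge> 0" for i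
  proof -
    have f: "facet_ratio a $ i \<ge> 0" by (simp add: facet_ratio_def alpha_norm_def)
    have "\<bar>(z - u) $ i\<bar> \<le> facet_ratio a $ i * norm (z - u)"
      by (rule coordinate_bound[OF pos]) (simp add: inner_diff_right u z)
    also have "\<dots> \<le> facet_ratio a $ i * q" using f z(3) by (intro mult_left_mono)
    finally show ?thesis using u(2)[of i] by (simp add: mult.commute)
  qed
  define x :: "nat ^ 'n" where "x = (\<chi> i. nat \<lfloor>z $ i\<rfloor>)"
  have zx: "z = rvec x" using nn z(1) by (simp add: vec_eq_iff rvec_def x_def)
  have "real (\<Sum>i\<in>UNIV. a $ i * x $ i) = real t"
    using z(2) unfolding zx inner_rvec by (simp add: rvec_def)
  then show ?thesis using zx unfolding representations_def by (auto simp del: of_nat_sum)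
qed

subsection \<open>Counting representations\<close>

lemma power_diff_le:
  fixes x y :: real
  assumes "0 \<le> y" "y \<le> x"
  shows "x ^ Suc n - y ^ Suc n \<le> real (Suc n) * (x - y) * x ^ n"
proof (induction n)
  case (Suc n)
  have "x ^ Suc (Suc n) - y ^ Suc (Suc n) = x * (x ^ Suc n - y ^ Suc n) + (x - y) * y ^ Suc n"
    by (simp add: algebra_simps)
  also have "\<dots> \<le> x * (real (Suc n) * (x - y) * x ^ n) + (x - y) * x ^ Suc n"
    using assms by (intro add_mono mult_left_mono Suc.IH power_mono) auto
  also have "\<dots> = real (Suc (Suc n)) * (x - y) * x ^ Suc n"
    by (simp add: algebra_simps)
  finally show ?case .
qed simp

text \<open>A left Riemann sum of step w for the decreasing function (T - x)^n is at least its
  integral T^(n+1) / (n+1) over [0, T].\<close>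

lemma power_le_arithmetic_sum:
  fixes w T :: real
  assumes w: "0 < w" and T: "0 \<le> T"
  shows "T ^ Suc n \<le> real (Suc n) * w * (\<Sum>j\<le>nat \<lfloor>T / w\<rfloor>. (T - w * real j) ^ n)"
proof -
  define m where "m = nat \<lfloor>T / w\<rfloor>"
  have "real m \<le> T / w" using w T by (simp add: m_def)
  then have wm: "w * real m \<le> T" using w by (simp add: field_simps)
  have "T / w < real m + 1" using w T unfolding m_def by (simp add: floor_less_iff[symmetric])
  then have mw: "T - w * real m \<le> w" using w by (simp add: field_simps)
  have step: "T ^ Suc n - (T - w * real l) ^ Suc n
      \<le> real (Suc n) * w * (\<Sum>j<l. (T - w * real j) ^ n)" if "w * real l \<le> T" for l
    using that
  proof (induction l)
    case (Suc l)
    have l: "w * real l \<le> T" using Suc.prems w by (simp add: algebra_simps)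
    have "(T - w * real l) ^ Suc n - (T - w * real (Suc l)) ^ Suc n
        \<le> real (Suc n) * ((T - w * real l) - (T - w * real (Suc l))) * (T - w * real l) ^ n"
      using Suc.prems w by (intro power_diff_le) (auto simp: algebra_simps)
    also have "\<dots> = real (Suc n) * w * (T - w * real l) ^ n" by (simp add: algebra_simps)
    finally show ?case using Suc.IH[OF l] by (simp add: distrib_left del: power_Suc of_nat_Suc)
  qed simp
  \<comment> \<open>The last, incomplete interval has length at most w, so its full-width rectangle
    also dominates.\<close>
  have "(T - w * real m) ^ Suc n \<le> w * (T - w * real m) ^ n"
    using mw wm by (simp add: mult_right_mono)
  also have "\<dots> \<le> real (Suc n) * w * (T - w * real m) ^ n"
    using w wm by (intro mult_right_mono) auto
  finally have "T ^ Suc n \<le> real (Suc n) * w * (\<Sum>j<Suc m. (T - w * real j) ^ n)"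
    using step[OF wm] by (simp add: distrib_left del: power_Suc of_nat_Suc)
  then show ?thesis by (simp add: m_def lessThan_Suc_atMost del: power_Suc of_nat_Suc sum.lessThan_Suc)
qed

text \<open>Extensional functions are used so that each point is counted only once.\<close>

definition weighted_points :: "('i \<Rightarrow> nat) \<Rightarrow> 'i set \<Rightarrow> real \<Rightarrow> ('i \<Rightarrow> nat) set" where
  "weighted_points w I T = {y \<in> I \<rightarrow>\<^sub>E UNIV. real (\<Sum>i\<in>I. w i * y i) \<le> T}"

lemma finite_weighted_points:
  assumes "finite I" "\<forall>i\<in>I. 0 < w i"
  shows "finite (weighted_points w I T)"
proof (rule finite_subset)
  show "weighted_points w I T \<subseteq> I \<rightarrow>\<^sub>E {..nat \<lfloor>T\<rfloor>}"
  proof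
    fix y assume y: "y \<in> weighted_points w I T"
    have "y i \<le> nat \<lfloor>T\<rfloor>" if "i \<in> I" for i
    proof -
      have "y i \<le> w i * y i" using assms that by (simp add: Suc_leI)
      also have "\<dots> \<le> (\<Sum>i\<in>I. w i * y i)" using assms that by (intro member_le_sum) auto
      finally have "real (y i) \<le> real (\<Sum>i\<in>I. w i * y i)" by (simp only: of_nat_le_iff)
      also have "\<dots> \<le> T" using y by (simp add: weighted_points_def)
      finally have "real (y i) \<le> T" .
      then show ?thesis by (simp add: le_nat_floor)
    qed
    then show "y \<in> I \<rightarrow>\<^sub>E {..nat \<lfloor>T\<rfloor>}" using y by (auto simp: weighted_points_def PiE_def)
  qed
  show "finite (I \<rightarrow>\<^sub>E {..nat \<lfloor>T\<rfloor>})" using assms by (intro finite_PiE) auto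
qed

text \<open>The count is at least the volume of the simplex. Induction slices by coordinate k: the
  slice at j is a simplex of size T - w_k j, and \<open>power_le_arithmetic_sum\<close> adds up the
  slices.\<close>

lemma card_weighted_points_ge:
  assumes "finite I" "\<forall>i\<in>I. 0 < w i" "0 \<le> T"
  shows "T ^ card I \<le> fact (card I) * (\<Prod>i\<in>I. real (w i)) * real (card (weighted_points w I T))"
  using assms
proof (induction I arbitrary: T rule: finite_induct)
  case empty
  then show ?case by (simp add: weighted_points_def)
next
  case (insert k I)
  define n where "n = card I"
  define W where "W = (\<Prod>i\<in>I. real (w i))"
  have wk: "w k > 0" using insert by auto
  define m where "m = nat \<lfloor>T / real (w k)\<rfloor>"
  have "real m \<le> T / real (w k)" using wk insert.prems by (simp add: m_def)
  then have "real (w k) * real m \<le> T" using wk by (simp add: field_simps)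
  then have nonneg: "0 \<le> T - real (w k) * real j" if "j \<le> m" for j
    using that mult_left_mono[of "real j" "real m" "real (w k)"] by simp
  define X where "X = Sigma {..m} (\<lambda>j. weighted_points w I (T - real (w k) * real j))"
  have inj: "inj_on (\<lambda>(j, y). y(k := j)) X"
  proof (rule inj_onI, clarify)
    fix j y j' y' assume *: "(j, y) \<in> X" "(j', y') \<in> X" and eq: "y(k := j) = y'(k := j')"
    have "y k = undefined" "y' k = undefined"
      using * insert.hyps by (auto simp: X_def weighted_points_def PiE_def extensional_def)
    then have "y i = y' i" for i using fun_cong[OF eq, of i] by (cases "i = k") auto
    then show "j = j' \<and> y = y'" using fun_cong[OF eq, of k] by auto
  qed
  have sub: "(\<lambda>(j, y). y(k := j)) ` X \<subseteq> weighted_points w (insert k I) T"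
  proof clarify
    fix j y assume *: "(j, y) \<in> X"
    have "(\<Sum>i\<in>I. w i * (y(k := j)) i) = (\<Sum>i\<in>I. w i * y i)"
      using insert.hyps by (intro sum.cong) auto
    then have "(\<Sum>i\<in>insert k I. w i * (y(k := j)) i) = w k * j + (\<Sum>i\<in>I. w i * y i)"
      using insert.hyps by simp
    moreover have "real (w k * j + (\<Sum>i\<in>I. w i * y i)) \<le> T" "y \<in> I \<rightarrow>\<^sub>E UNIV"
      using * by (auto simp: X_def weighted_points_def)
    ultimately show "y(k := j) \<in> weighted_points w (insert k I) T"
      unfolding weighted_points_def
      by (simp del: of_nat_sum of_nat_mult sum.insert fun_upd_apply) (auto simp: PiE_def extensional_def)
  qed
  have "card X \<le> card (weighted_points w (insert k I) T)"
    using card_inj_on_le[OF inj sub] finite_weighted_points[of "insert k I" w T] insert by auto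
  moreover have "card X = (\<Sum>j\<le>m. card (weighted_points w I (T - real (w k) * real j)))"
    unfolding X_def using insert.hyps insert.prems by (intro card_SigmaI) (auto intro: finite_weighted_points)
  ultimately have card: "(\<Sum>j\<le>m. real (card (weighted_points w I (T - real (w k) * real j))))
      \<le> real (card (weighted_points w (insert k I) T))"
    by (metis of_nat_le_iff of_nat_sum)
  have "T ^ Suc n \<le> real (Suc n) * real (w k) * (\<Sum>j\<le>m. (T - real (w k) * real j) ^ n)"
    unfolding m_def using wk insert.prems by (intro power_le_arithmetic_sum) auto
  also have "\<dots> \<le> real (Suc n) * real (w k) *
      (\<Sum>j\<le>m. fact n * W * real (card (weighted_points w I (T - real (w k) * real j))))"
    unfolding n_def W_def using insert.prems nonneg
    by (intro mult_left_mono sum_mono insert.IH) auto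
  also have "\<dots> = real (Suc n) * real (w k) * fact n * W *
      (\<Sum>j\<le>m. real (card (weighted_points w I (T - real (w k) * real j))))"
    by (simp add: sum_distrib_left mult_ac)
  also have "\<dots> \<le> real (Suc n) * real (w k) * fact n * W * real (card (weighted_points w (insert k I) T))"
    by (intro mult_left_mono card) (auto simp: W_def prod_nonneg)
  also have "\<dots> = fact (Suc n) * (real (w k) * W) * real (card (weighted_points w (insert k I) T))"
    by simp
  finally show ?case using insert.hyps by (simp add: n_def W_def)
qed

lemma card_representations_ge:
  fixes a :: "nat ^ 'n"
  assumes pos: "\<forall>i. 0 < a $ i" and gcd: "Gcd (range (\<lambda>i. a $ i)) = 1"
    and q: "covering_radius a < q" and t: "q * (rvec a \<bullet> facet_ratio a) \<le> real t"
  shows "(real t - q * (rvec a \<bullet> facet_ratio a)) ^ (CARD('n) - 1)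
    \<le> fact (CARD('n) - 1) * (\<Prod>i\<in>UNIV. real (a $ i)) * real (card (representations a t))"
proof -
  define k :: 'n where "k = undefined"
  define c where "c = facet_ratio a"
  define T where "T = real t - q * (rvec a \<bullet> c)"
  have T: "T \<ge> 0" using t by (simp add: T_def c_def)
  define I where "I = UNIV - {k}"
  have I: "finite I" "k \<notin> I" "UNIV = insert k I" "card I = CARD('n) - 1"
    by (auto simp: I_def)
  define Y where "Y = weighted_points (\<lambda>i. a $ i) I T"
  have finY: "finite Y" unfolding Y_def using pos I by (intro finite_weighted_points) auto
  define S where "S = (\<lambda>y. \<Sum>i\<in>I. a $ i * y i)"
  \<comment> \<open>The classes are the residues of S y modulo a_k; the most populated one holds at
    least a fraction 1 / a_k of Y.\<close>
  obtain r where r: "card Y \<le> card ((\<lambda>y. S y mod a $ k) -` {r} \<inter> Y) * a $ k"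
    using pigeonhole_card[of "\<lambda>y. S y mod a $ k" Y "{..<a $ k}"] finY pos
    by (auto simp: Pi_iff lessThan_empty_iff)
  define K where "K = (\<lambda>y. S y mod a $ k) -` {r} \<inter> Y"
  \<comment> \<open>Coordinate k is forced by the equation of the layer and need not be an integer;
    it is at least q c_k since S y is at most T on Y.\<close>
  define u :: "('n \<Rightarrow> nat) \<Rightarrow> real ^ 'n" where
    "u = (\<lambda>y. (\<chi> i. (if i = k then (T - real (S y)) / real (a $ k) else real (y i)) + q * c $ i))"
  have ak: "real (a $ k) > 0" using pos by simp
  have au: "rvec a \<bullet> u y = real t" for y
  proof -
    have "rvec a \<bullet> u y = (\<Sum>i\<in>UNIV. real (a $ i) * (if i = k then (T - real (S y)) / real (a $ k) else real (y i)))
        + (\<Sum>i\<in>UNIV. real (a $ i) * (q * c $ i))"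
      by (simp add: inner_rvec u_def algebra_simps sum.distrib)
    also have "(\<Sum>i\<in>UNIV. real (a $ i) * (q * c $ i)) = q * (rvec a \<bullet> c)"
      by (simp add: inner_rvec sum_distrib_left mult_ac)
    also have "(\<Sum>i\<in>UNIV. real (a $ i) * (if i = k then (T - real (S y)) / real (a $ k) else real (y i)))
      = (T - real (S y)) + (\<Sum>i\<in>I. real (a $ i) * real (y i))"
    proof -
      have "(\<Sum>i\<in>I. real (a $ i) * (if i = k then (T - real (S y)) / real (a $ k) else real (y i)))
        = (\<Sum>i\<in>I. real (a $ i) * real (y i))" using I(2) by (intro sum.cong) auto
      then show ?thesis using I(1,2) ak by (subst I(3), subst sum.insert) auto
    qed
    also have "\<dots> = T" by (simp add: S_def)
    finally show ?thesis by (simp add: T_def)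
  qed
  have uc: "q * facet_ratio a $ i \<le> u y $ i" if "y \<in> Y" for y i
    using that ak by (simp add: u_def c_def Y_def S_def weighted_points_def)
  have injY: "inj_on u Y"
  proof (rule inj_onI)
    fix y y' assume yy: "y \<in> Y" "y' \<in> Y" and eq: "u y = u y'"
    have "y i = y' i" if "i \<in> I" for i
    proof -
      have "u y $ i = u y' $ i" using eq by simp
      then show ?thesis using that I(2) by (cases "i = k") (auto simp: u_def)
    qed
    moreover have "y \<in> I \<rightarrow>\<^sub>E UNIV" "y' \<in> I \<rightarrow>\<^sub>E UNIV"
      using yy by (auto simp: Y_def weighted_points_def)
    ultimately show "y = y'" by (meson PiE_ext)
  qed
  have fin: "finite (representations a t)" using pos by (intro finite_representations) auto
  have "card K \<le> card (representations a t)"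
  proof (cases "K = {}")
    case False
    then obtain y0 where y0: "y0 \<in> K" by auto
    obtain z where z: "\<forall>i. z $ i \<in> \<int>" "rvec a \<bullet> z = real t" "norm (z - u y0) \<le> q"
      using integer_point_near[OF pos gcd q au] by blast
    \<comment> \<open>Equal residues make u y - u y0 integral also in coordinate k, so the rounding
      z - u y0 found for one point serves the whole class.\<close>
    have "z + (u y - u y0) \<in> rvec ` representations a t" if y: "y \<in> K" for y
    proof (rule integer_point_near_is_representation[OF pos au])
      show "q * facet_ratio a $ i \<le> u y $ i" for i using uc y by (auto simp: K_def)
      show "norm (z + (u y - u y0) - u y) \<le> q" using z by (simp add: algebra_simps)
      show "rvec a \<bullet> (z + (u y - u y0)) = real t" using z au by (simp add: inner_add_right inner_diff_right)
      have "int (S y) mod int (a $ k) = int (S y0) mod int (a $ k)"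
        using y y0 by (simp add: K_def flip: of_nat_mod)
      then obtain d where d: "int (S y) - int (S y0) = int (a $ k) * d"
        by (metis mod_eq_dvd_iff dvdE)
      then have "real (S y) - real (S y0) = real (a $ k) * of_int d"
        by (metis of_int_diff of_int_mult of_int_of_nat_eq)
      then have "(u y - u y0) $ k = - of_int d"
        using ak by (simp add: u_def field_simps)
      then have "(u y - u y0) $ i \<in> \<int>" for i by (cases "i = k") (auto simp: u_def)
      then show "\<forall>i. (z + (u y - u y0)) $ i \<in> \<int>" using z by (auto simp del: vector_minus_component)
    qed
    then have "(\<lambda>y. z + (u y - u y0)) ` K \<subseteq> rvec ` representations a t" by blast
    moreover have "inj_on (\<lambda>y. z + (u y - u y0)) K"
      using injY by (auto simp: inj_on_def K_def)
    ultimately have "card K \<le> card (rvec ` representations a t)"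
      using fin by (intro card_inj_on_le) auto
    also have "\<dots> \<le> card (representations a t)" using fin by (rule card_image_le)
    finally show ?thesis .
  qed simp
  then have "card Y \<le> card (representations a t) * a $ k"
    using r unfolding K_def by (meson le_trans mult_le_mono1)
  then have Yle: "real (card Y) \<le> real (a $ k) * real (card (representations a t))"
    by (metis mult.commute of_nat_le_iff of_nat_mult)
  have "T ^ (CARD('n) - 1) \<le> fact (CARD('n) - 1) * (\<Prod>i\<in>I. real (a $ i)) * real (card Y)"
    using card_weighted_points_ge[of I "\<lambda>i. a $ i" T] pos I T unfolding Y_def by auto
  also have "\<dots> \<le> fact (CARD('n) - 1) * (\<Prod>i\<in>I. real (a $ i)) * (real (a $ k) * real (card (representations a t)))"
    by (intro mult_left_mono Yle) (auto simp: prod_nonneg)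
  also have "\<dots> = fact (CARD('n) - 1) * (\<Prod>i\<in>UNIV. real (a $ i)) * real (card (representations a t))"
    using I by (subst I(3), subst prod.insert) auto
  finally show ?thesis by (simp add: T_def c_def)
qed

subsection \<open>Packing balls into the simplex\<close>

lemma card_packing_le:
  fixes a :: "nat ^ 'n"
  assumes pos: "\<forall>i. 0 < a $ i" and gcd: "Gcd (range (\<lambda>i. a $ i)) = 1"
    and q: "covering_radius a < q"
    and D: "\<And>u. u \<in> D \<Longrightarrow> rvec a \<bullet> u = real t" "\<And>u i. u \<in> D \<Longrightarrow> q * facet_ratio a $ i \<le> u $ i"
    and sep: "\<And>u v. u \<in> D \<Longrightarrow> v \<in> D \<Longrightarrow> u \<noteq> v \<Longrightarrow> 2 * q \<le> dist u v"
  shows "card D \<le> card (representations a t)"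
proof -
  have fin: "finite (representations a t)" using pos by (intro finite_representations) auto
  \<comment> \<open>Balls of radius q may touch. With the smaller radius q' they are disjoint, so
    distinct centres receive distinct representations.\<close>
  obtain q' where q': "covering_radius a < q'" "q' < q" using dense[OF q] by blast
  have "\<exists>z. z \<in> rvec ` representations a t \<and> norm (z - u) \<le> q'" if u: "u \<in> D" for u
  proof -
    obtain z where z: "\<forall>i. z $ i \<in> \<int>" "rvec a \<bullet> z = real t" "norm (z - u) \<le> q'"
      using integer_point_near[OF pos gcd q'(1) D(1)[OF u]] .
    then show ?thesis
      using integer_point_near_is_representation[OF pos D(1)[OF u] D(2)[OF u] z(1,2)] q'
      by auto
  qed
  then obtain f where f: "\<And>u. u \<in> D \<Longrightarrow> f u \<in> rvec ` representations a t"
      "\<And>u. u \<in> D \<Longrightarrow> norm (f u - u) \<le> q'" by metis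
  have "inj_on f D"
  proof (rule inj_onI, rule ccontr)
    fix u v assume uv: "u \<in> D" "v \<in> D" "f u = f v" "u \<noteq> v"
    have "dist u v \<le> norm (f u - u) + norm (f v - v)"
      using uv dist_triangle2[of u v "f u"] by (simp add: dist_norm norm_minus_commute)
    then show False using f(2)[OF uv(1)] f(2)[OF uv(2)] sep[OF uv(1,2,4)] q' by linarith
  qed
  then have "card D \<le> card (rvec ` representations a t)"
    using f fin by (intro card_inj_on_le[of f]) auto
  also have "\<dots> \<le> card (representations a t)" using fin by (rule card_image_le)
  finally show ?thesis .
qed

section \<open>Kissing configurations and their transfer to the hyperplane\<close>

lemma disjoint_unit_balls_dist:
  assumes xy: "x \<in> Rn n" "y \<in> Rn n" and disj: "Rn.mball n x 1 \<inter> Rn.mball n y 1 = {}"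
  shows "2 \<le> Rn_dist n x y"
proof (rule ccontr)
  assume less: "\<not> 2 \<le> Rn_dist n x y"
  \<comment> \<open>The midpoint of centres closer than 2 would lie in both open balls.\<close>
  define m where "m = restrict (\<lambda>i. (x i + y i) / 2) {..<n}"
  have m: "m \<in> Rn n" by (simp add: m_def Rn_def)
  have "Rn_dist n x m = L2_set (\<lambda>i. (1/2) * (x i - y i)) {..<n}"
    unfolding Rn_dist_def by (rule L2_set_cong) (auto simp: m_def field_simps)
  moreover have "Rn_dist n m y = L2_set (\<lambda>i. (1/2) * (x i - y i)) {..<n}"
    unfolding Rn_dist_def by (rule L2_set_cong) (auto simp: m_def field_simps)
  moreover have "L2_set (\<lambda>i. (1/2) * (x i - y i)) {..<n} = (1/2) * Rn_dist n x y"
    unfolding Rn_dist_def by (rule L2_set_right_distrib[symmetric]) simp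
  ultimately have "m \<in> Rn.mball n x 1 \<inter> Rn.mball n y 1"
    using less m xy by (simp add: Rn.in_mball Rn.commute[of n y m])
  then show False using disj by blast
qed

lemma kissing_configuration_dist:
  assumes "kissing_configuration n p C"
  shows "c \<in> C \<Longrightarrow> Rn_dist n c p = 2"
    and "c \<in> C \<Longrightarrow> d \<in> C \<Longrightarrow> c \<noteq> d \<Longrightarrow> 2 \<le> Rn_dist n c d"
proof -
  have C: "p \<in> Rn n" "C \<subseteq> Rn n" using assms by (auto simp: kissing_configuration_def)
  show "Rn_dist n c p = 2" if c: "c \<in> C"
  proof (rule antisym)
    show "2 \<le> Rn_dist n c p"
      using assms c C by (intro disjoint_unit_balls_dist) (auto simp: kissing_configuration_def)
    have "Rn.mcball n c 1 \<inter> Rn.mcball n p 1 \<noteq> {}" using assms c by (simp add: kissing_configuration_def)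
    then obtain x where x: "x \<in> Rn n" "Rn_dist n c x \<le> 1" "Rn_dist n p x \<le> 1"
      by (auto simp: Rn.in_mcball)
    then show "Rn_dist n c p \<le> 2"
      using Rn.triangle[of c n x p] Rn.commute[of n x p] C c by auto
  qed
  show "2 \<le> Rn_dist n c d" if "c \<in> C" "d \<in> C" "c \<noteq> d"
    using assms that C by (intro disjoint_unit_balls_dist) (auto simp: kissing_configuration_def)
qed

text \<open>Carries a configuration of coordinate sequences into the hyperplane of the simplex, by
  way of an orthonormal basis of the latter.\<close>

lemma isometry_into_hyperplane:
  fixes v :: "'a::euclidean_space"
  assumes "v \<noteq> 0"
  obtains \<phi> :: "(nat \<Rightarrow> real) \<Rightarrow> 'a"
  where "\<And>x. v \<bullet> \<phi> x = 0" "\<And>x y. norm (\<phi> x - \<phi> y) = Rn_dist (DIM('a) - 1) x y"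
proof -
  define n where "n = DIM('a) - 1"
  obtain B where B: "B \<subseteq> {x. v \<bullet> x = 0}" "pairwise orthogonal B" "\<And>x. x \<in> B \<Longrightarrow> norm x = 1"
      "independent B" "card B = dim {x. v \<bullet> x = 0}"
    using orthonormal_basis_subspace[OF subspace_hyperplane[of v]] by metis
  have "card B = n" using B(5) dim_hyperplane[OF assms] by (simp add: n_def)
  moreover have "finite B" using B(4) by (rule independent_imp_finite)
  ultimately obtain b where b: "bij_betw b {..<n} B"
    using ex_bij_betw_nat_finite[of B] by (metis atLeast0LessThan)
  have bB: "b i \<in> B" if "i < n" for i using b that by (auto simp: bij_betw_def)
  define \<phi> where "\<phi> = (\<lambda>x :: nat \<Rightarrow> real. \<Sum>i<n. x i *\<^sub>R b i)"
  have "v \<bullet> \<phi> x = 0" for x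
  proof -
    have "v \<bullet> b i = 0" if "i < n" for i using bB[OF that] B(1) by auto
    then show ?thesis by (simp add: \<phi>_def inner_sum_right)
  qed
  moreover have "norm (\<phi> x - \<phi> y) = Rn_dist n x y" for x y
  proof -
    have orth: "orthogonal (b i) (b j)" if "i < n" "j < n" "i \<noteq> j" for i j
      using B(2) b that by (auto simp: pairwise_def bij_betw_def inj_on_def)
    have "\<phi> x - \<phi> y = (\<Sum>i<n. (x i - y i) *\<^sub>R b i)"
      by (simp add: \<phi>_def scaleR_diff_left sum_subtractf)
    moreover have "(norm (\<Sum>i<n. (x i - y i) *\<^sub>R b i))\<^sup>2 = (\<Sum>i<n. (norm ((x i - y i) *\<^sub>R b i))\<^sup>2)"
      by (rule norm_sum_Pythagorean) (auto simp: pairwise_def orthogonal_def intro: orth[unfolded orthogonal_def])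
    moreover have "\<dots> = (\<Sum>i<n. (x i - y i)\<^sup>2)"
      using B(3)[OF bB] by (intro sum.cong) auto
    ultimately show ?thesis
      by (metis L2_set_def Rn_dist_def norm_ge_zero real_sqrt_abs2 real_sqrt_unique)
  qed
  ultimately show ?thesis using that[of \<phi>] by (simp add: n_def)
qed

lemma facet_ratio_pos:
  fixes a :: "nat ^ 'n"
  assumes "2 \<le> CARD('n)" and pos: "\<forall>i. 0 < a $ i"
  shows "0 < facet_ratio a $ i"
proof -
  have "card (UNIV - {i}) \<noteq> 0" using assms(1) by (simp add: card_Diff_singleton)
  then have "UNIV - {i} \<noteq> {}" by (metis card.empty)
  then obtain j where "j \<in> UNIV - {i}" by blast
  then have "real (a $ j) \<le> alpha_norm a i" unfolding alpha_norm_def by (intro member_le_L2_set) auto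
  moreover have "0 < real (a $ j)" using pos by simp
  ultimately have "0 < alpha_norm a i" by linarith
  then show ?thesis using rvec_nonzero[OF pos] by (simp add: facet_ratio_def)
qed

lemma inner_facet_ratio:
  "rvec a \<bullet> facet_ratio a = (\<Sum>i\<in>UNIV. alpha_norm a i * real (a $ i)) / norm (rvec a)"
  by (simp add: inner_rvec facet_ratio_def sum_divide_distrib mult.commute)

lemma kissing_configuration_card_le:
  fixes a :: "nat ^ 'n"
  assumes N: "3 \<le> CARD('n)" and pos: "\<forall>i. 0 < a $ i" and gcd: "Gcd (range (\<lambda>i. a $ i)) = 1"
    and t: "3 * covering_radius a * (rvec a \<bullet> facet_ratio a) < real t"
    and kiss: "kissing_configuration (CARD('n) - 1) p C"
  shows "card C + 2 \<le> card (representations a t)"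
proof -
  define c where "c = facet_ratio a"
  define \<sigma> where "\<sigma> = rvec a \<bullet> c"
  \<comment> \<open>The inradius t / \<sigma> becomes 3 q, and the hypothesis on t says precisely
    that q exceeds the covering radius.\<close>
  define q where "q = real t / (3 * \<sigma>)"
  have c: "0 < c $ i" for i unfolding c_def using N pos by (intro facet_ratio_pos) auto
  have \<sigma>: "\<sigma> > 0" unfolding \<sigma>_def inner_rvec using c pos by (intro sum_pos) auto
  have tq: "real t = 3 * q * \<sigma>" using \<sigma> by (simp add: q_def)
  have q: "covering_radius a < q" using t \<sigma> by (simp add: q_def field_simps \<sigma>_def c_def)
  then have q0: "q > 0" using covering_radius_nonneg[OF pos] by linarith
  have bound: "\<bar>x $ i\<bar> \<le> c $ i * norm x" if "rvec a \<bullet> x = 0" for x i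
    unfolding c_def by (rule coordinate_bound[OF pos that])
  define P where "P = (3 * q) *\<^sub>R c"
  have aP: "rvec a \<bullet> P = real t" by (simp add: P_def tq \<sigma>_def)

  \<comment> \<open>Vertex \<open>k\<close> of \<open>S(t)\<close> is at distance at least \<open>6 q\<close> from the incentre \<open>P\<close>; the
      corner ball around \<open>E\<close> is the image of the inball under the homothety with centre \<open>v\<close> and ratio 1/3.\<close>
  obtain k where k: "real CARD('n) * (real (a $ k) * c $ k) \<le> \<sigma>"
  proof (rule ccontr)
    assume "\<not> thesis"
    then have "\<sigma> < real CARD('n) * (real (a $ k) * c $ k)" for k
      using that[of k] by (meson not_le)
    then have "\<sigma> / real CARD('n) < real (a $ k) * c $ k" for k
      by (simp add: divide_less_eq mult.commute)
    then have "(\<Sum>k\<in>(UNIV :: 'n set). \<sigma> / real CARD('n)) < (\<Sum>k\<in>UNIV. real (a $ k) * c $ k)"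
      by (intro sum_strict_mono) auto
    then show False by (simp add: \<sigma>_def inner_rvec)
  qed
  define v :: "real ^ 'n" where "v = (real t / real (a $ k)) *\<^sub>R axis k 1"
  have ak: "real (a $ k) > 0" using pos by simp
  have av: "rvec a \<bullet> v = real t" using ak by (simp add: v_def inner_axis rvec_def)
  have v0: "v $ i \<ge> 0" for i by (simp add: v_def axis_def)
  define E where "E = (1/3) *\<^sub>R P + (2/3) *\<^sub>R v"
  have aE: "rvec a \<bullet> E = real t" by (simp add: E_def inner_add_right aP av)
  have Ec: "q * c $ i \<le> E $ i" for i using v0[of i] by (simp add: E_def P_def)
  \<comment> \<open>As a_k c_k is at most \<sigma> / 3, coordinate k of v is at least 9 q c_k,
    against 3 q c_k for P. By \<open>coordinate_bound\<close> this gap forces distance 6 q, of which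
    E keeps two thirds.\<close>
  have EP: "norm (E - P) \<ge> 4 * q"
  proof -
    have "3 * (real (a $ k) * c $ k) \<le> real CARD('n) * (real (a $ k) * c $ k)"
      using N ak c[of k] by (intro mult_right_mono) auto
    then have "3 * q * (3 * (real (a $ k) * c $ k)) \<le> 3 * q * \<sigma>"
      using k q0 by (intro mult_left_mono) auto
    then have "9 * q * c $ k \<le> real t / real (a $ k)"
      using ak tq by (simp add: field_simps)
    also have "\<dots> = (v - P) $ k + 3 * q * c $ k" by (simp add: v_def P_def)
    finally have "6 * q * c $ k \<le> \<bar>(v - P) $ k\<bar>" by (simp add: algebra_simps)
    also have "\<dots> \<le> c $ k * norm (v - P)" by (rule bound) (simp add: inner_diff_right av aP)
    finally have "6 * q \<le> norm (v - P)" using c[of k] by (simp add: mult.commute)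
    moreover have "E - P = (2/3) *\<^sub>R (v - P)"
      by (simp add: E_def vec_eq_iff field_simps)
    ultimately show ?thesis by simp
  qed

  obtain \<phi> :: "(nat \<Rightarrow> real) \<Rightarrow> real ^ 'n" where \<phi>: "\<And>x. rvec a \<bullet> \<phi> x = 0"
      "\<And>x y. norm (\<phi> x - \<phi> y) = Rn_dist (CARD('n) - 1) x y"
    using isometry_into_hyperplane[OF rvec_nonzero[OF pos]] by auto
  \<comment> \<open>Scales the configuration by q and moves its centre p to the incentre P.\<close>
  define f where "f = (\<lambda>x. P + q *\<^sub>R (\<phi> x - \<phi> p))"
  have af: "rvec a \<bullet> f x = real t" for x by (simp add: f_def inner_add_right inner_diff_right \<phi>(1) aP)
  have fP: "norm (f x - P) = 2 * q" if "x \<in> C" for x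
    using kissing_configuration_dist(1)[OF kiss that] \<phi>(2) q0 by (simp add: f_def)
  have ff: "norm (f x - f y) \<ge> 2 * q" if "x \<in> C" "y \<in> C" "x \<noteq> y" for x y
  proof -
    have "f x - f y = q *\<^sub>R (\<phi> x - \<phi> y)" by (simp add: f_def algebra_simps)
    then show ?thesis
      using kissing_configuration_dist(2)[OF kiss that] \<phi>(2) q0 by simp
  qed
  have fE: "norm (f x - E) \<ge> 2 * q" if "x \<in> C" for x
  proof -
    have "norm (E - P) \<le> norm (f x - E) + norm (f x - P)"
      using norm_triangle_ineq4[of "f x - P" "f x - E"] by (simp add: add.commute)
    then show ?thesis using fP[OF that] EP by linarith
  qed
  \<comment> \<open>P has clearance 3 q from every facet and f x is 2 q away from P, which leaves
    clearance q.\<close>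
  have fc: "q * c $ i \<le> f x $ i" if "x \<in> C" for x i
  proof -
    have "\<bar>(f x - P) $ i\<bar> \<le> c $ i * norm (f x - P)" by (rule bound) (simp add: inner_diff_right af aP)
    then show ?thesis using fP[OF that] by (simp add: P_def mult_ac)
  qed

  define D where "D = insert E (insert P (f ` C))"
  have "card D \<le> card (representations a t)"
  proof (rule card_packing_le[OF pos gcd q])
    show "rvec a \<bullet> u = real t" if "u \<in> D" for u using that aE aP af by (auto simp: D_def)
    have "q * c $ i \<le> P $ i" for i using q0 c[of i] by (simp add: P_def)
    then show "q * facet_ratio a $ i \<le> u $ i" if "u \<in> D" for u i
      using that Ec fc by (auto simp: D_def c_def)
    show "2 * q \<le> dist u w" if "u \<in> D" "w \<in> D" "u \<noteq> w" for u w
      using that EP q0 fP fE ff unfolding D_def dist_norm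
      by (auto simp: norm_minus_commute)
  qed
  moreover have "card D = card C + 2"
  proof -
    have "finite C" using kiss by (simp add: kissing_configuration_def)
    moreover have "inj_on f C" using ff q0 by (force simp: inj_on_def)
    moreover have "P \<notin> f ` C" using fP q0 by force
    moreover have "E \<noteq> P" using EP q0 by auto
    moreover have "E \<notin> f ` C" using fE q0 by force
    ultimately show ?thesis by (simp add: D_def card_image)
  qed
  ultimately show ?thesis by simp
qed

text \<open>
  The finite number of representations also bounds the sizes of kissing configurations, so the
  supremum defining the kissing number is not a junk value.
\<close>
lemma kissing_number_less:
  fixes a :: "nat ^ 'n"
  assumes "3 \<le> CARD('n)" "\<forall>i. 0 < a $ i" "Gcd (range (\<lambda>i. a $ i)) = 1"
    and "3 * covering_radius a * (rvec a \<bullet> facet_ratio a) < real t"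
  shows "kissing_number (CARD('n) - 1) + 1 < card (representations a t)"
proof -
  have le: "card C + 2 \<le> card (representations a t)"
    if "kissing_configuration (CARD('n) - 1) p C" for p C
    using kissing_configuration_card_le[OF assms that] .
  have empty: "kissing_configuration (CARD('n) - 1) (\<lambda>i\<in>{..<CARD('n) - 1}. 0) {}"
    by (simp add: kissing_configuration_def Rn_def)
  have "kissing_number (CARD('n) - 1) \<le> card (representations a t) - 2"
    unfolding kissing_number_def
  proof (rule cSup_least)
    show "{card C |p C. kissing_configuration (CARD('n) - 1) p C} \<noteq> {}" using empty by blast
  qed (use le in force)
  \<comment> \<open>The empty configuration yields two representations, so the truncated subtraction
    above loses nothing.\<close>
  then show ?thesis using le[OF empty] by simp
qed

subsection \<open>Bounds on the Frobenius number\<close>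

text \<open>Nonnegativity of B covers the default value 0, taken when no positive integer has
  exactly s representations.\<close>

lemma s_frobenius_le:
  assumes "0 \<le> B" and "\<And>t. B < real t \<Longrightarrow> card (representations a t) \<noteq> s"
  shows "real (s_frobenius s a) \<le> B"
proof -
  have "s_frobenius s a \<le> nat \<lfloor>B\<rfloor>"
  proof (cases "{t. 0 < t \<and> card (representations a t) = s} = {}")
    case True
    then show ?thesis unfolding s_frobenius_def by (simp only: True) (simp add: Sup_nat_def)
  next
    case False
    have "t \<le> nat \<lfloor>B\<rfloor>" if "card (representations a t) = s" for t
      using assms(2)[of t] that by (intro le_nat_floor) linarith
    then show ?thesis unfolding s_frobenius_def using False by (intro cSup_least) auto
  qed
  then have "real (s_frobenius s a) \<le> real (nat \<lfloor>B\<rfloor>)" by simp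
  also have "\<dots> \<le> B" using assms(1) by simp
  finally show ?thesis .
qed

lemma less_card_representations:
  fixes a :: "nat ^ 'n"
  assumes N: "3 \<le> CARD('n)" and pos: "\<forall>i. 0 < a $ i" and gcd: "Gcd (range (\<lambda>i. a $ i)) = 1"
    and t: "covering_radius a * (real CARD('n) - 1) * (rvec a \<bullet> facet_ratio a) + 1 < real t"
    and s: "real s * fact (CARD('n) - 1) * (\<Prod>i\<in>UNIV. real (a $ i)) < real t ^ (CARD('n) - 2)"
  shows "s < card (representations a t)"
proof -
  define \<sigma> where "\<sigma> = rvec a \<bullet> facet_ratio a"
  define n where "n = CARD('n) - 1"
  define A where "A = fact (CARD('n) - 1) * (\<Prod>i\<in>UNIV. real (a $ i))"
  have n: "2 \<le> n" "real n = real CARD('n) - 1" "CARD('n) - 2 = n - 1" using N by (auto simp: n_def)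
  have A: "0 < A" unfolding A_def using pos by (auto intro!: mult_pos_pos prod_pos)
  have \<sigma>: "\<sigma> > 0" unfolding \<sigma>_def inner_rvec using facet_ratio_pos[OF _ pos] N pos
    by (intro sum_pos) auto
  \<comment> \<open>Chosen so that n q \<sigma> = t - 1. Bernoulli's factor 1 - n q \<sigma> / t is
    then exactly 1 / t, which explains both the summand 1 and the exponent N - 2 in the
    bound.\<close>
  define q where "q = (real t - 1) / (real n * \<sigma>)"
  have q: "covering_radius a < q"
    using t n(1) \<sigma> unfolding n(2)[symmetric] \<sigma>_def[symmetric] by (simp add: q_def field_simps)
  have nq: "real n * (q * \<sigma>) = real t - 1" using \<sigma> n(1) by (simp add: q_def)
  have q0: "0 \<le> q * \<sigma>" using q \<sigma> covering_radius_nonneg[OF pos] by simp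
  then have t1: "1 \<le> real t" using nq by (smt (verit) mult_nonneg_nonneg of_nat_0_le_iff)
  have "1 * (q * \<sigma>) \<le> real n * (q * \<sigma>)" using q0 n(1) by (intro mult_right_mono) auto
  then have qt: "q * \<sigma> \<le> real t" using nq by simp
  have "real t ^ (n - 1) = real t ^ n * (1 + real n * (- (q * \<sigma> / real t)))"
  proof -
    have "real t ^ n = real t * real t ^ (n - 1)" using n(1) by (metis power_eq_if not_numeral_le_zero)
    moreover have "1 + real n * (- (q * \<sigma> / real t)) = (real t - real n * (q * \<sigma>)) / real t"
      using t1 by (simp add: field_simps)
    ultimately show ?thesis using nq t1 by simp
  qed
  also have "\<dots> \<le> real t ^ n * (1 + (- (q * \<sigma> / real t))) ^ n"
    using qt t1 by (intro mult_left_mono Bernoulli_inequality) (auto simp: field_simps)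
  also have "\<dots> = (real t - q * \<sigma>) ^ n"
    using t1 by (simp add: power_mult_distrib[symmetric] field_simps)
  also have "\<dots> \<le> A * real (card (representations a t))"
    unfolding n_def A_def \<sigma>_def
    by (rule card_representations_ge[OF pos gcd q]) (use qt in \<open>simp add: \<sigma>_def\<close>)
  finally have "real t ^ (n - 1) \<le> A * real (card (representations a t))" .
  moreover have "real s * A < real t ^ (n - 1)" using s by (simp only: n(3) A_def mult.assoc)
  ultimately have "real s * A < A * real (card (representations a t))" by linarith
  then show ?thesis using A by (simp add: mult.commute)
qed

theorem theorem2p1:
  fixes a :: "nat ^ 'n" and s :: nat
  assumes "CARD('n) \<ge> 3"
    and "\<forall>i. 0 < a $ i"
    and "Gcd (range (\<lambda>i. a $ i)) = 1"
  shows
    "real (s_frobenius s a)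
       \<le> max (covering_radius a * (real CARD('n) - 1) * (\<Sum>i\<in>UNIV. alpha_norm a i * real (a $ i))
                 / norm (rvec a) + 1)
              ((real s * fact (CARD('n) - 1) * (\<Prod>i\<in>UNIV. real (a $ i)))
                 powr (1 / (real CARD('n) - 2)))
     \<and> (s \<le> kissing_number (CARD('n) - 1) + 1 \<longrightarrow>
          real (s_frobenius s a)
            \<le> 3 * covering_radius a * (\<Sum>i\<in>UNIV. alpha_norm a i * real (a $ i)) / norm (rvec a))"
proof -
  note N = assms(1) and pos = assms(2) and gcd = assms(3)
  define \<Sigma> where "\<Sigma> = (\<Sum>i\<in>UNIV. alpha_norm a i * real (a $ i))"
  define A where "A = real s * fact (CARD('n) - 1) * (\<Prod>i\<in>UNIV. real (a $ i))"
  define B where "B = max (covering_radius a * (real CARD('n) - 1) * \<Sigma> / norm (rvec a) + 1)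
    (A powr (1 / (real CARD('n) - 2)))"
  have \<sigma>: "rvec a \<bullet> facet_ratio a = \<Sigma> / norm (rvec a)" by (simp add: inner_facet_ratio \<Sigma>_def)
  have R: "0 \<le> covering_radius a" by (rule covering_radius_nonneg[OF pos])
  have \<Sigma>: "0 \<le> \<Sigma>" by (simp add: \<Sigma>_def alpha_norm_def sum_nonneg)
  have A: "0 \<le> A" by (simp add: A_def prod_nonneg)
  have "real (s_frobenius s a) \<le> B"
  proof (rule s_frobenius_le)
    show "0 \<le> B" by (simp add: B_def le_max_iff_disj)
    fix t assume t: "B < real t"
    \<comment> \<open>This includes s = 0, where A = 0 and \<open>powr\<close> with base 0 gives
      0.\<close>
    have "A = (A powr (1 / (real CARD('n) - 2))) powr (real CARD('n) - 2)"
      using N A by (simp add: powr_powr)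
    also have "\<dots> < real t powr (real CARD('n) - 2)"
      using t N by (intro powr_less_mono2) (auto simp: B_def)
    also have "\<dots> = real t powr real (CARD('n) - 2)" using N by simp
    also have "\<dots> = real t ^ (CARD('n) - 2)"
    proof (rule powr_realpow)
      show "0 < real t" using t powr_ge_zero[of A] unfolding B_def by (meson le_less_trans max_less_iff_conj)
    qed
    finally have "s < card (representations a t)"
      using t by (intro less_card_representations[OF N pos gcd]) (auto simp: A_def B_def \<sigma>)
    then show "card (representations a t) \<noteq> s" by simp
  qed
  moreover have "real (s_frobenius s a) \<le> 3 * covering_radius a * \<Sigma> / norm (rvec a)"
    if "s \<le> kissing_number (CARD('n) - 1) + 1"
  proof (rule s_frobenius_le)
    show "0 \<le> 3 * covering_radius a * \<Sigma> / norm (rvec a)" using R \<Sigma> by simp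
    fix t assume "3 * covering_radius a * \<Sigma> / norm (rvec a) < real t"
    then have "kissing_number (CARD('n) - 1) + 1 < card (representations a t)"
      by (intro kissing_number_less[OF N pos gcd]) (simp add: \<sigma>)
    then show "card (representations a t) \<noteq> s" using that by simp
  qed
  ultimately show ?thesis by (simp add: B_def A_def \<Sigma>_def)
qed

end
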